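(* Let $f(t)=\sum_{S\subseteq[n]}f_S\,t^S\in\mathcal{LC}_n$ and let $\lambda_1,\dots,\lambda_n\ge0$ be real numbers. Define $f^\lambda(t):=f(\lambda_1t_1,\dots,\lambda_nt_n)$. Then $f^\lambda\in\mathcal{LC}_n$.
   Context: $[n]=\{1,\dots,n\}$. The squarefree algebra $\mathcal{A}_n:=\mathbb{R}[t_1,\dots,t_n]/(t_1^2,\dots,t_n^2)$ has basis $\{t^S: S\subseteq[n]\}$ with $t^S:=\prod_{i\in S}t_i$, $t^\varnothing=1$; write $f=\sum_{S\subseteq[n]}f_S t^S$ with $f_S\in\mathbb{R}$, and identify $f$ with this multiaffine polynomial. For $f\in\mathcal{A}_n$ with $f_\varnothing=1$, define $\log f:=\sum_{k=1}^n\frac{(-1)^{k+1}}{k}(f-1)^k=\sum_{\varnothing\ne S\subseteq[n]}\kappa_S(f)\,t^S$. $\mathcal{LC}_n$ is the set of $f\in\mathcal{A}_n$ with $f_S\ge0$ for all $S\subseteq[n]$, $f_\varnothing=1$, and $\kappa_S(f)\le0$ for all $S\subseteq[n]$ with $|S|\ge2$. *)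

theory Defs
  imports Complex_Main
begin

text \<open>
  The ring of all squarefree real polynomials in the variables \<open>var 0, var 1, \<dots>\<close>, i.e.
  the quotient of the polynomial ring by the ideal generated by the squares of the variables.
  An element is given by its coefficients in the basis of squarefree monomials, which are indexed
  by the finite sets of naturals.  The algebra in the variables \<open>var 1, \<dots>, var n\<close> is the
  subalgebra \<open>sqfree_algebra n\<close> below.
\<close>

typedef sqfree = "{f :: nat set \<Rightarrow> real. finite {S. f S \<noteq> 0} \<and> (\<forall>S. f S \<noteq> 0 \<longrightarrow> finite S)}"
  morphisms coeff Abs_sqfree
  by (rule exI[of _ "\<lambda>_. 0"]) simp

setup_lifting type_definition_sqfree

lemma sqfree_eqI: "(\<And>S. coeff f S = coeff g S) \<Longrightarrow> f = g"
  by (simp add: coeff_inject[symmetric] ext)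

lemma finite_coeff: "finite {S. coeff f S \<noteq> 0}"
  using coeff[of f] by simp

lemma coeff_infinite: "infinite S \<Longrightarrow> coeff f S = 0"
  using coeff[of f] by auto

instantiation sqfree :: real_vector
begin

lift_definition zero_sqfree :: sqfree is "\<lambda>_. 0" by simp

lift_definition plus_sqfree :: "sqfree \<Rightarrow> sqfree \<Rightarrow> sqfree" is "\<lambda>f g S. f S + g S"
proof -
  fix f g :: "nat set \<Rightarrow> real"
  assume "finite {S. f S \<noteq> 0} \<and> (\<forall>S. f S \<noteq> 0 \<longrightarrow> finite S)"
    and "finite {S. g S \<noteq> 0} \<and> (\<forall>S. g S \<noteq> 0 \<longrightarrow> finite S)"
  moreover have "{S. f S + g S \<noteq> 0} \<subseteq> {S. f S \<noteq> 0} \<union> {S. g S \<noteq> 0}"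
    by auto
  ultimately show "finite {S. f S + g S \<noteq> 0} \<and> (\<forall>S. f S + g S \<noteq> 0 \<longrightarrow> finite S)"
    using finite_subset[of "{S. f S + g S \<noteq> 0}" "{S. f S \<noteq> 0} \<union> {S. g S \<noteq> 0}"]
    by fastforce
qed

lift_definition uminus_sqfree :: "sqfree \<Rightarrow> sqfree" is "\<lambda>f S. - f S" by simp

definition minus_sqfree :: "sqfree \<Rightarrow> sqfree \<Rightarrow> sqfree" where
  "minus_sqfree f g = f + - g"

lift_definition scaleR_sqfree :: "real \<Rightarrow> sqfree \<Rightarrow> sqfree" is "\<lambda>c f S. c * f S"
  by simp

instance
  by standard
    (auto intro!: sqfree_eqI simp: zero_sqfree.rep_eq plus_sqfree.rep_eq uminus_sqfree.rep_eq
      minus_sqfree_def scaleR_sqfree.rep_eq algebra_simps)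

end

lemma coeff_0 [simp]: "coeff 0 S = 0"
  by (simp add: zero_sqfree.rep_eq)

lemma coeff_add [simp]: "coeff (f + g) S = coeff f S + coeff g S"
  by (simp add: plus_sqfree.rep_eq)

lemma coeff_uminus [simp]: "coeff (- f) S = - coeff f S"
  by (simp add: uminus_sqfree.rep_eq)

lemma coeff_diff [simp]: "coeff (f - g) S = coeff f S - coeff g S"
  unfolding minus_sqfree_def by (simp only: coeff_add coeff_uminus diff_conv_add_uminus)

lemma coeff_scaleR [simp]: "coeff (c *\<^sub>R f) S = c * coeff f S"
  by (simp add: scaleR_sqfree.rep_eq)

lemma coeff_sum: "coeff (\<Sum>i\<in>I. f i) S = (\<Sum>i\<in>I. coeff (f i) S)"
  by (induction I rule: infinite_finite_induct) auto

instantiation sqfree :: "{real_algebra_1, comm_ring_1}"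
begin

lift_definition one_sqfree :: sqfree is "\<lambda>S. if S = {} then 1 else 0"
  by (auto simp: Collect_conv_if)

text \<open>
  Two squarefree monomials indexed by \<open>T\<close> and \<open>U\<close> multiply to the one indexed by
  \<open>T \<union> U\<close> if \<open>T\<close> and \<open>U\<close> are disjoint, and to zero otherwise.
\<close>

lift_definition times_sqfree :: "sqfree \<Rightarrow> sqfree \<Rightarrow> sqfree" is
  "\<lambda>f g S. \<Sum>T\<in>Pow S. f T * g (S - T)"
proof -
  fix f g :: "nat set \<Rightarrow> real"
  assume f: "finite {S. f S \<noteq> 0} \<and> (\<forall>S. f S \<noteq> 0 \<longrightarrow> finite S)"
    and g: "finite {S. g S \<noteq> 0} \<and> (\<forall>S. g S \<noteq> 0 \<longrightarrow> finite S)"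
  let ?P = "\<lambda>S. \<Sum>T\<in>Pow S. f T * g (S - T)"
  have "{S. ?P S \<noteq> 0} \<subseteq> (\<lambda>(T, U). T \<union> U) ` ({S. f S \<noteq> 0} \<times> {S. g S \<noteq> 0})"
  proof
    fix S assume "S \<in> {S. ?P S \<noteq> 0}"
    then have "?P S \<noteq> 0" by simp
    then obtain T where T: "T \<subseteq> S" "f T * g (S - T) \<noteq> 0"
      by (rule sum.not_neutral_contains_not_neutral) simp
    then have "(T, S - T) \<in> {S. f S \<noteq> 0} \<times> {S. g S \<noteq> 0}"
      by simp
    then have "T \<union> (S - T) \<in> (\<lambda>(T, U). T \<union> U) ` ({S. f S \<noteq> 0} \<times> {S. g S \<noteq> 0})"
      by (rule rev_image_eqI) simp
    moreover have "T \<union> (S - T) = S"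
      using T(1) by (rule Diff_partition)
    ultimately show "S \<in> (\<lambda>(T, U). T \<union> U) ` ({S. f S \<noteq> 0} \<times> {S. g S \<noteq> 0})"
      by (simp only:)
  qed
  moreover have "finite ((\<lambda>(T, U). T \<union> U) ` ({S. f S \<noteq> 0} \<times> {S. g S \<noteq> 0}))"
    using f g by (intro finite_imageI finite_cartesian_product) simp_all
  ultimately have "finite {S. ?P S \<noteq> 0}"
    by (rule finite_subset)
  moreover have "finite S" if "?P S \<noteq> 0" for S
  proof (rule ccontr)
    assume "infinite S"
    then have "?P S = 0" by simp
    with that show False by contradiction
  qed
  ultimately show "finite {S. ?P S \<noteq> 0} \<and> (\<forall>S. ?P S \<noteq> 0 \<longrightarrow> finite S)"
    by blast
qed

instance
proof
  fix f g h :: sqfree and c :: real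
  show comm: "f * g = g * f" for f g :: sqfree
  proof (rule sqfree_eqI)
    fix S
    show "coeff (f * g) S = coeff (g * f) S"
      unfolding times_sqfree.rep_eq
      by (rule sum.reindex_bij_witness[of _ "\<lambda>T. S - T" "\<lambda>T. S - T"])
        (auto simp: double_diff)
  qed
  show "f * g * h = f * (g * h)"
  proof (rule sqfree_eqI)
    fix S
    show "coeff (f * g * h) S = coeff (f * (g * h)) S"
    proof (cases "finite S")
      case False
      then show ?thesis by (simp add: coeff_infinite)
    next
      case True
      then have fin: "finite T" if "T \<subseteq> S" for T
        using finite_subset that by blast
      have "coeff (f * g * h) S =
          (\<Sum>(T, U)\<in>(SIGMA T:Pow S. Pow T). coeff f U * coeff g (T - U) * coeff h (S - T))"
        using True fin by (simp add: times_sqfree.rep_eq sum_distrib_right sum.Sigma)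
      also have "\<dots> =
          (\<Sum>(T, U)\<in>(SIGMA T:Pow S. Pow (S - T)). coeff f T * (coeff g U * coeff h (S - T - U)))"
        proof (rule sum.reindex_bij_witness[of _ "\<lambda>(T, U). (T \<union> U, T)" "\<lambda>(T, U). (U, T - U)"],
            goal_cases)
          case (5 p)
          then obtain T U where p: "p = (T, U)" "U \<subseteq> T" "T \<subseteq> S"
            by auto
          then have "S - U - (T - U) = S - T"
            by blast
          with p show ?case
            by (simp add: mult.assoc)
        qed auto
      also have "\<dots> = coeff (f * (g * h)) S"
        using True fin by (simp add: times_sqfree.rep_eq sum_distrib_left sum.Sigma)
      finally show ?thesis .
    qed
  qed
  show one: "1 * f = f" for f :: sqfree
  proof (rule sqfree_eqI)
    fix S
    show "coeff (1 * f) S = coeff f S"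
    proof (cases "finite S")
      case False
      then show ?thesis by (simp add: coeff_infinite)
    next
      case True
      have "coeff (1 * f) S = (\<Sum>T\<in>Pow S. if T = {} then coeff f S else 0)"
        unfolding times_sqfree.rep_eq one_sqfree.rep_eq by (intro sum.cong) auto
      with True show ?thesis by simp
    qed
  qed
  show "f * 1 = f"
    using comm one by metis
  show add: "(f + g) * h = f * h + g * h" for f g h :: sqfree
    by (rule sqfree_eqI) (simp add: times_sqfree.rep_eq sum.distrib distrib_right)
  show "f * (g + h) = f * g + f * h"
    using comm add by metis
  show scale: "c *\<^sub>R f * g = c *\<^sub>R (f * g)" for f g :: sqfree
    by (rule sqfree_eqI) (simp add: times_sqfree.rep_eq sum_distrib_left mult.assoc)
  show "f * c *\<^sub>R g = c *\<^sub>R (f * g)"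
    using comm scale by metis
  have "coeff (0 :: sqfree) {} \<noteq> coeff 1 {}"
    by (simp add: one_sqfree.rep_eq)
  then show "(0 :: sqfree) \<noteq> 1"
    by metis
qed

end

lemma coeff_1: "coeff 1 S = (if S = {} then 1 else 0)"
  by (simp add: one_sqfree.rep_eq)

lemma coeff_mult: "coeff (f * g) S = (\<Sum>T\<in>Pow S. coeff f T * coeff g (S - T))"
  by (simp add: times_sqfree.rep_eq)

lift_definition var :: "nat \<Rightarrow> sqfree" is "\<lambda>i S. if S = {i} then 1 else 0"
  by (auto simp: Collect_conv_if)

text \<open>
  The next three facts, with the ring structure, pin down the algebra: the variables square to
  zero, and the squarefree monomials form a basis in which \<open>coeff\<close> gives the coordinates.
\<close>

lemma var_square: "var i ^ 2 = 0"
proof (rule sqfree_eqI)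
  fix S
  have "coeff (var i) T * coeff (var i) (S - T) = 0" if "T \<subseteq> S" for T
    using that by (auto simp: var.rep_eq)
  then show "coeff (var i ^ 2) S = coeff 0 S"
    unfolding power2_eq_square coeff_mult coeff_0 by (intro sum.neutral) blast
qed

lemma coeff_monomial:
  assumes "finite A"
  shows "coeff (\<Prod>i\<in>A. var i) S = (if S = A then 1 else 0)"
  using assms
proof (induction A arbitrary: S)
  case empty
  then show ?case by (simp add: coeff_1)
next
  case (insert a A)
  show ?case
  proof (cases "finite S")
    case False
    then show ?thesis using insert.hyps by (auto simp: coeff_infinite)
  next
    case True
    have "coeff (\<Prod>i\<in>insert a A. var i) S =
        (\<Sum>T\<in>Pow S. if T = {a} then (if S - {a} = A then 1 else 0) else 0)"
      unfolding prod.insert[OF insert.hyps] coeff_mult insert.IH var.rep_eq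
      by (intro sum.cong) auto
    also have "\<dots> = (if a \<in> S \<and> S - {a} = A then 1 else 0)"
      using True by simp
    also have "a \<in> S \<and> S - {a} = A \<longleftrightarrow> S = insert a A"
      using insert.hyps by auto
    finally show ?thesis .
  qed
qed

definition sqfree_algebra :: "nat \<Rightarrow> sqfree set" where
  "sqfree_algebra n = {f. \<forall>S. coeff f S \<noteq> 0 \<longrightarrow> S \<subseteq> {1..n}}"

lemma sqfree_expansion:
  assumes "f \<in> sqfree_algebra n"
  shows "f = (\<Sum>S\<in>Pow {1..n}. coeff f S *\<^sub>R (\<Prod>i\<in>S. var i))"
proof (rule sqfree_eqI)
  fix S
  have "coeff (\<Sum>A\<in>Pow {1..n}. coeff f A *\<^sub>R (\<Prod>i\<in>A. var i)) S =
      (\<Sum>A\<in>Pow {1..n}. if A = S then coeff f S else 0)"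
    unfolding coeff_sum by (intro sum.cong) (auto simp: coeff_monomial[OF finite_subset[OF _ finite_atLeastAtMost]])
  also have "\<dots> = coeff f S"
    using assms by (auto simp: sqfree_algebra_def)
  finally show "coeff f S = coeff (\<Sum>A\<in>Pow {1..n}. coeff f A *\<^sub>R (\<Prod>i\<in>A. var i)) S" ..
qed

text \<open>
  Only meaningful for elements of \<open>sqfree_algebra n\<close> with constant coefficient one: then
  \<open>(f - 1) ^ k = 0\<close> for \<open>k > n\<close>, so this is the full logarithm series.
\<close>

definition log_sqfree :: "nat \<Rightarrow> sqfree \<Rightarrow> sqfree" where
  "log_sqfree n f = (\<Sum>k=1..n. ((-1) ^ (k + 1) / real k) *\<^sub>R (f - 1) ^ k)"

definition kappa :: "nat \<Rightarrow> sqfree \<Rightarrow> nat set \<Rightarrow> real" where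
  "kappa n f S = coeff (log_sqfree n f) S"

definition LC :: "nat \<Rightarrow> sqfree set" where
  "LC n = {f \<in> sqfree_algebra n.
     (\<forall>S\<subseteq>{1..n}. coeff f S \<ge> 0) \<and> coeff f {} = 1 \<and>
     (\<forall>S\<subseteq>{1..n}. card S \<ge> 2 \<longrightarrow> kappa n f S \<le> 0)}"

text \<open>
  The value \<open>f (g 1, \<dots>, g n)\<close> of the multiaffine polynomial \<open>f\<close>.  It does not depend
  on the choice of representative of \<open>f\<close> modulo the squares of the variables when every
  \<open>g i\<close> squares to zero, as in \<open>rescale\<close>.
\<close>

definition compose_sqfree :: "nat \<Rightarrow> sqfree \<Rightarrow> (nat \<Rightarrow> sqfree) \<Rightarrow> sqfree" where
  "compose_sqfree n f g = (\<Sum>S\<in>Pow {1..n}. coeff f S *\<^sub>R (\<Prod>i\<in>S. g i))"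

definition rescale :: "nat \<Rightarrow> (nat \<Rightarrow> real) \<Rightarrow> sqfree \<Rightarrow> sqfree" where
  "rescale n l f = compose_sqfree n f (\<lambda>i. l i *\<^sub>R var i)"

end

theory Submission
  imports Defs
begin

text \<open>
  Substituting \<open>\<lambda>\<^sub>i t\<^sub>i\<close> for \<open>t\<^sub>i\<close> multiplies the coefficient of \<open>t\<^sup>S\<close> by \<open>\<Prod>\<^sub>i\<^sub>\<in>\<^sub>S \<lambda>\<^sub>i\<close>.
  These weights are multiplicative on disjoint unions, so the substitution commutes with products
  and hence with the logarithm: the coefficient \<open>\<kappa>\<^sub>S\<close> is multiplied by the same
  nonnegative weight and keeps its sign.
\<close>

lemma prod_scaleR_var:
  "(\<Prod>i\<in>S. l i *\<^sub>R var i) = (\<Prod>i\<in>S. l i) *\<^sub>R (\<Prod>i\<in>S. var i)"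
  by (simp add: scaleR_conv_of_real prod.distrib)

lemma coeff_rescale:
  assumes "f \<in> sqfree_algebra n"
  shows "coeff (rescale n l f) S = (\<Prod>i\<in>S. l i) * coeff f S"
proof -
  have "coeff (rescale n l f) S =
      (\<Sum>A\<in>Pow {1..n}. if A = S then (\<Prod>i\<in>S. l i) * coeff f S else 0)"
    unfolding rescale_def compose_sqfree_def coeff_sum
    by (intro sum.cong)
      (auto simp: prod_scaleR_var coeff_monomial[OF finite_subset[OF _ finite_atLeastAtMost]])
  \<comment> \<open>If \<open>S\<close> is not a subset of \<open>{1..n}\<close>, no summand has
    \<open>A = S\<close>, and \<open>coeff f S = 0\<close> because \<open>f\<close> lies in
    \<open>sqfree_algebra n\<close>.\<close>
  also have "\<dots> = (\<Prod>i\<in>S. l i) * coeff f S"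
    using assms by (auto simp: sqfree_algebra_def)
  finally show ?thesis .
qed

text \<open>Stated for any elements related by the weights, so that it applies directly to
  \<open>f - 1\<close> and its powers.\<close>

lemma coeff_mult_weighted:
  assumes f: "\<And>S. coeff f' S = (\<Prod>i\<in>S. l i) * coeff f S"
    and g: "\<And>S. coeff g' S = (\<Prod>i\<in>S. l i) * coeff g S"
  shows "coeff (f' * g') S = (\<Prod>i\<in>S. l i) * coeff (f * g) S"
proof (cases "finite S")
  case False
  then show ?thesis by (simp add: coeff_infinite)
next
  case True
  have "coeff f' T * coeff g' (S - T) = (\<Prod>i\<in>S. l i) * (coeff f T * coeff g (S - T))"
    if "T \<subseteq> S" for T
    using prod.subset_diff[OF that True, of l] by (simp add: f g ac_simps)
  then show ?thesis
    by (simp add: coeff_mult sum_distrib_left)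
qed

lemma coeff_power_weighted:
  assumes "\<And>S. coeff f' S = (\<Prod>i\<in>S. l i) * coeff f S"
  shows "coeff (f' ^ k) S = (\<Prod>i\<in>S. l i) * coeff (f ^ k) S"
proof (induction k arbitrary: S)
  case 0
  show ?case by (simp add: coeff_1)
next
  case (Suc k)
  then show ?case
    unfolding power_Suc by (intro coeff_mult_weighted assms)
qed

lemma kappa_rescale:
  assumes "f \<in> sqfree_algebra n"
  shows "kappa n (rescale n l f) S = (\<Prod>i\<in>S. l i) * kappa n f S"
proof -
  \<comment> \<open>Subtracting 1 changes only the coefficient at \<open>{}\<close>, where the
    weight is the empty product 1.\<close>
  have "coeff (rescale n l f - 1) T = (\<Prod>i\<in>T. l i) * coeff (f - 1) T" for T
    by (simp add: coeff_rescale[OF assms] coeff_1)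
  then have "coeff ((rescale n l f - 1) ^ k) S = (\<Prod>i\<in>S. l i) * coeff ((f - 1) ^ k) S" for k
    by (rule coeff_power_weighted)
  then show ?thesis
    by (simp add: kappa_def log_sqfree_def coeff_sum sum_distrib_left ac_simps)
qed

theorem proposition5p4:
  fixes n :: nat and f :: sqfree and l :: "nat \<Rightarrow> real"
  assumes "f \<in> LC n"
    and "\<And>i. i \<in> {1..n} \<Longrightarrow> l i \<ge> 0"
  shows "rescale n l f \<in> LC n"
proof -
  have f: "f \<in> sqfree_algebra n"
    using assms(1) by (simp add: LC_def)
  have weight: "(\<Prod>i\<in>S. l i) \<ge> 0" if "S \<subseteq> {1..n}" for S
    using that assms(2) by (intro prod_nonneg) blast
  have "rescale n l f \<in> sqfree_algebra n"
    using f by (simp add: sqfree_algebra_def coeff_rescale[OF f])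
  then show ?thesis
    using assms(1) weight
    by (simp add: LC_def coeff_rescale[OF f] kappa_rescale[OF f] mult_nonneg_nonpos)
qed

end
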